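(* Let $f,g\in T(X,\mathcal{P})$. Then $(f,g)\in \mathcal{J}$ in $T(X,\mathcal{P})$ if and only if there exist $E$-preserving mappings $\varphi\colon Xg\to X$ and $\psi\colon Xf\to X$ such that for each $i\in I$, there exist $j,k\in I$ such that $X_if\subseteq (X_jg)\varphi$ and $X_ig\subseteq (X_kf)\psi$.
   Context: $X$ is a nonempty set (possibly infinite) and $\mathcal{P}=\{X_i : i\in I\}$ is a partition of $X$ into nonempty blocks, with $X_i\cap X_j=\varnothing$ for $i\neq j$; $E$ is the equivalence relation on $X$ whose classes are the blocks of $\mathcal{P}$. $T(X)$ denotes the semigroup of all maps $X\to X$ under composition. Maps are written on the right and composed from left to right: $x(fg)=(xf)g$; $Af=\{af: a\in A\}$. $T(X,\mathcal{P})$ is the subsemigroup (containing $\mathrm{id}_X$) of all $f\in T(X)$ such that for every $i\in I$ there is $j\in I$ with $X_if\subseteq X_j$. For nonempty $Y,Z\subseteq X$, a mapping $\varphi\colon Y\to Z$ is $E$-preserving if for all $x,y\in Y$, $(x,y)\in E$ implies $(x\varphi,y\varphi)\in E$. In a semigroup $S$ with identity, Green's relation $\mathcal{J}$ is: $(a,b)\in\mathcal{J}$ iff $SaS=SbS$. *)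

theory Defs
  imports "HOL-Library.FuncSet" "HOL-Library.Disjoint_Sets" "HOL-Algebra.Coset"
begin

text \<open>Maps \<open>X \<rightarrow> X\<close> are represented by the extensional functions in \<^term>\<open>X \<rightarrow>\<^sub>E X\<close>, so that two
  elements of \<open>T(X)\<close> are equal iff they agree on \<open>X\<close>. Maps act on the right in the mathematical
  text, so the product \<open>f g\<close> means ``first \<open>f\<close>, then \<open>g\<close>'', i.e. \<^term>\<open>compose X g f\<close>.\<close>

definition full_transf :: "'a set \<Rightarrow> ('a \<Rightarrow> 'a) monoid" where
  "full_transf X =
     \<lparr>carrier = X \<rightarrow>\<^sub>E X, mult = (\<lambda>f g. compose X g f), one = (\<lambda>x\<in>X. x)\<rparr>"

definition indexed_partition :: "'a set \<Rightarrow> 'i set \<Rightarrow> ('i \<Rightarrow> 'a set) \<Rightarrow> bool" where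
  "indexed_partition X I B \<longleftrightarrow>
     (\<Union>i\<in>I. B i) = X \<and> (\<forall>i\<in>I. B i \<noteq> {}) \<and> disjoint_family_on B I"

definition transf_partition :: "'a set \<Rightarrow> 'i set \<Rightarrow> ('i \<Rightarrow> 'a set) \<Rightarrow> ('a \<Rightarrow> 'a) monoid" where
  "transf_partition X I B =
     (full_transf X)
       \<lparr>carrier := {f \<in> carrier (full_transf X). \<forall>i\<in>I. \<exists>j\<in>I. f ` B i \<subseteq> B j}\<rparr>"

definition block_rel :: "'i set \<Rightarrow> ('i \<Rightarrow> 'a set) \<Rightarrow> ('a \<times> 'a) set" where
  "block_rel I B = {(x, y). \<exists>i\<in>I. x \<in> B i \<and> y \<in> B i}"

definition rel_preserving :: "('a \<times> 'a) set \<Rightarrow> 'a set \<Rightarrow> 'a set \<Rightarrow> ('a \<Rightarrow> 'a) \<Rightarrow> bool" where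
  "rel_preserving E Y Z \<phi> \<longleftrightarrow>
     \<phi> \<in> Y \<rightarrow>\<^sub>E Z \<and> (\<forall>x\<in>Y. \<forall>y\<in>Y. (x, y) \<in> E \<longrightarrow> (\<phi> x, \<phi> y) \<in> E)"

text \<open>Green's relation \<open>\<J>\<close> in the form \<open>S a S = S b S\<close>, which is the usual one only because
  \<open>S\<close> has an identity.\<close>

definition Green_J :: "('a, 'b) monoid_scheme \<Rightarrow> ('a \<times> 'a) set" where
  "Green_J S = {(a, b). a \<in> carrier S \<and> b \<in> carrier S \<and>
     carrier S <#>\<^bsub>S\<^esub> {a} <#>\<^bsub>S\<^esub> carrier S = carrier S <#>\<^bsub>S\<^esub> {b} <#>\<^bsub>S\<^esub> carrier S}"

lemma indexed_partition_unique:
  assumes "indexed_partition X I B" "i \<in> I" "j \<in> I" "x \<in> B i" "x \<in> B j"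
  shows "i = j"
  using assms by (auto simp: indexed_partition_def disjoint_family_on_def)

lemma equiv_block_rel:
  assumes "indexed_partition X I B"
  shows "equiv X (block_rel I B)"
proof (rule equivI)
  show "block_rel I B \<subseteq> X \<times> X" "refl_on X (block_rel I B)" "sym (block_rel I B)"
    using assms by (auto simp: indexed_partition_def block_rel_def refl_on_def sym_def)
  show "trans (block_rel I B)"
    unfolding block_rel_def trans_def
    by clarsimp (metis indexed_partition_unique[OF assms])
qed

lemma quotient_block_rel:
  assumes "indexed_partition X I B"
  shows "X // block_rel I B = B ` I"
proof -
  have cls: "block_rel I B `` {x} = B i" if "i \<in> I" "x \<in> B i" for i x
    using that indexed_partition_unique[OF assms that(1)] by (auto simp: block_rel_def)
  show ?thesis
  proof
    show "X // block_rel I B \<subseteq> B ` I"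
      using assms cls by (force simp: quotient_def indexed_partition_def)
    show "B ` I \<subseteq> X // block_rel I B"
    proof
      fix A assume "A \<in> B ` I"
      then obtain i where i: "i \<in> I" "A = B i" by blast
      then obtain x where "x \<in> B i" using assms by (auto simp: indexed_partition_def)
      with i cls[of i x] assms show "A \<in> X // block_rel I B"
        by (auto simp: quotient_def indexed_partition_def)
    qed
  qed
qed

lemma monoid_transf_partition:
  assumes "indexed_partition X I B"
  shows "monoid (transf_partition X I B)"
proof -
  have sub: "B i \<subseteq> X" if "i \<in> I" for i
    using assms that by (auto simp: indexed_partition_def)
  have comp: "\<exists>k\<in>I. compose X g f ` B i \<subseteq> B k"
    if h: "\<forall>i\<in>I. \<exists>j\<in>I. f ` B i \<subseteq> B j" "\<forall>i\<in>I. \<exists>j\<in>I. g ` B i \<subseteq> B j" "i \<in> I" for f g i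
  proof -
    obtain j where j: "j \<in> I" "f ` B i \<subseteq> B j" using h(1,3) by meson
    obtain k where k: "k \<in> I" "g ` B j \<subseteq> B k" using h(2) j(1) by meson
    have "compose X g f ` B i \<subseteq> B k"
      using j k sub[OF \<open>i \<in> I\<close>] by (auto simp: compose_def)
    with k show ?thesis by blast
  qed
  have one: "\<exists>j\<in>I. (\<lambda>x\<in>X. x) ` B i \<subseteq> B j" if "i \<in> I" for i
    using sub[OF that] that by (intro bexI[of _ i]) auto
  have fc: "compose X g f \<in> X \<rightarrow>\<^sub>E X" if "f \<in> X \<rightarrow>\<^sub>E X" "g \<in> X \<rightarrow>\<^sub>E X" for f g
    using that by (auto simp: compose_def PiE_def)
  have car: "f \<in> carrier (transf_partition X I B) \<longleftrightarrow>
      f \<in> X \<rightarrow>\<^sub>E X \<and> (\<forall>i\<in>I. \<exists>j\<in>I. f ` B i \<subseteq> B j)" for f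
    by (simp add: transf_partition_def full_transf_def)
  have mlt: "f \<otimes>\<^bsub>transf_partition X I B\<^esub> g = compose X g f" for f g
    by (simp add: transf_partition_def full_transf_def)
  have unit: "\<one>\<^bsub>transf_partition X I B\<^esub> = (\<lambda>x\<in>X. x)"
    by (simp add: transf_partition_def full_transf_def)
  have id: "(\<lambda>x\<in>X. x) \<in> X \<rightarrow>\<^sub>E X"
    by simp
  show ?thesis
  proof (rule monoidI, unfold car mlt unit)
    fix f g
    assume "f \<in> X \<rightarrow>\<^sub>E X \<and> (\<forall>i\<in>I. \<exists>j\<in>I. f ` B i \<subseteq> B j)"
      and "g \<in> X \<rightarrow>\<^sub>E X \<and> (\<forall>i\<in>I. \<exists>j\<in>I. g ` B i \<subseteq> B j)"
    then show "compose X g f \<in> X \<rightarrow>\<^sub>E X \<and> (\<forall>i\<in>I. \<exists>j\<in>I. compose X g f ` B i \<subseteq> B j)"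
      using fc[of f g] comp[of f g] by simp
  next
    show "(\<lambda>x\<in>X. x) \<in> X \<rightarrow>\<^sub>E X \<and> (\<forall>i\<in>I. \<exists>j\<in>I. (\<lambda>x\<in>X. x) ` B i \<subseteq> B j)"
      using id one by (intro conjI ballI)
  next
    fix f g h
    assume "f \<in> X \<rightarrow>\<^sub>E X \<and> (\<forall>i\<in>I. \<exists>j\<in>I. f ` B i \<subseteq> B j)"
    then show "compose X h (compose X g f) = compose X (compose X h g) f"
      using compose_assoc[of f X X h g] by (simp add: PiE_def)
  next
    fix f
    assume "f \<in> X \<rightarrow>\<^sub>E X \<and> (\<forall>i\<in>I. \<exists>j\<in>I. f ` B i \<subseteq> B j)"
    then have f: "f \<in> X \<rightarrow> X" "f \<in> extensional X" by (auto simp: PiE_def)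
    show "compose X f (\<lambda>x\<in>X. x) = f" using f by (rule compose_Id)
    show "compose X (\<lambda>x\<in>X. x) f = f" using f by (rule Id_compose)
  qed
qed

end

theory Submission
  imports Defs
begin

text \<open>In a monoid \<open>S\<close>, \<open>S f S = S g S\<close> says that each of \<open>f\<close> and \<open>g\<close> lies in the principal two-sided
  ideal of the other, so the theorem reduces to one half used twice: \<open>f = u g v\<close> is solvable in
  \<open>T(X, \<P>)\<close> iff some \<open>E\<close>-preserving \<open>\<phi>\<close> on \<open>Xg\<close> covers each \<open>X\<^sub>i f\<close> by some \<open>(X\<^sub>j g)\<phi>\<close>
  (\<open>mem_principal_ideal_iff\<close>).

  Given \<open>f = u g v\<close>, take \<open>\<phi>\<close> to be \<open>v\<close> restricted to \<open>Xg\<close>, and \<open>X\<^sub>j\<close> to be the block into which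
  \<open>u\<close> sends \<open>X\<^sub>i\<close>. Conversely, the covering property says that every \<open>x \<in> X\<^sub>i\<close> has a preimage of
  \<open>x f\<close> under \<open>g \<phi>\<close> inside one block chosen once for all of \<open>X\<^sub>i\<close>, and picking these preimages gives
  \<open>u\<close>. The left factor therefore takes care of the blocks, and the only thing left is to turn the
  partial map \<open>\<phi>\<close> into an element \<open>v\<close> of the semigroup; since different blocks impose no conditions
  on each other, this extension always exists (\<open>rel_preserving_extend\<close>).\<close>

lemma mem_principal_ideal:
  "a \<in> carrier S <#>\<^bsub>S\<^esub> {b} <#>\<^bsub>S\<^esub> carrier S \<longleftrightarrow>
     (\<exists>u\<in>carrier S. \<exists>v\<in>carrier S. a = u \<otimes>\<^bsub>S\<^esub> b \<otimes>\<^bsub>S\<^esub> v)"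
  by (auto simp: set_mult_def)

lemma (in monoid) principal_ideal_subset:
  assumes b: "b \<in> carrier G" and a: "a \<in> carrier G <#> {b} <#> carrier G"
  shows "carrier G <#> {a} <#> carrier G \<subseteq> carrier G <#> {b} <#> carrier G"
proof
  fix c assume "c \<in> carrier G <#> {a} <#> carrier G"
  then obtain s t where s: "s \<in> carrier G" and t: "t \<in> carrier G" and c: "c = s \<otimes> a \<otimes> t"
    unfolding mem_principal_ideal by blast
  obtain u v where u: "u \<in> carrier G" and v: "v \<in> carrier G" and a: "a = u \<otimes> b \<otimes> v"
    using a unfolding mem_principal_ideal by blast
  have "c = (s \<otimes> u) \<otimes> b \<otimes> (v \<otimes> t)"
    using b s t u v by (simp add: a c m_assoc)
  then show "c \<in> carrier G <#> {b} <#> carrier G"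
    unfolding mem_principal_ideal using s t u v by blast
qed

text \<open>The identity puts \<open>a\<close> into \<open>S a S\<close>, so that equality of the ideals is the same as mutual
  membership of the generators.\<close>

lemma (in monoid) Green_J_iff:
  assumes a: "a \<in> carrier G" and b: "b \<in> carrier G"
  shows "(a, b) \<in> Green_J G \<longleftrightarrow>
    a \<in> carrier G <#> {b} <#> carrier G \<and> b \<in> carrier G <#> {a} <#> carrier G"
proof -
  have self: "c \<in> carrier G <#> {c} <#> carrier G" if "c \<in> carrier G" for c
    unfolding mem_principal_ideal using that by (intro bexI[of _ \<one>]) auto
  show ?thesis
    using self[OF a] self[OF b] principal_ideal_subset[OF a, of b] principal_ideal_subset[OF b, of a] a b
    unfolding Green_J_def by auto
qed

text \<open>Having blocks sent into blocks is the same as preserving \<open>E\<close>, because blocks are nonempty: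
  the image of one point of a block determines the block that receives all of it.\<close>

lemma carrier_transf_partition_iff:
  assumes P: "indexed_partition X I B"
  shows "f \<in> carrier (transf_partition X I B) \<longleftrightarrow> rel_preserving (block_rel I B) X X f"
    (is "?L \<longleftrightarrow> ?R")
proof
  assume ?L
  then have f: "f \<in> X \<rightarrow>\<^sub>E X" "\<forall>i\<in>I. \<exists>j\<in>I. f ` B i \<subseteq> B j"
    by (simp_all add: transf_partition_def full_transf_def)
  have "(f x, f y) \<in> block_rel I B" if xy: "(x, y) \<in> block_rel I B" for x y
  proof -
    obtain i where i: "i \<in> I" "x \<in> B i" "y \<in> B i" using xy by (auto simp: block_rel_def)
    then obtain j where "j \<in> I" "f ` B i \<subseteq> B j" using f(2) by blast
    then show ?thesis using i by (auto simp: block_rel_def)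
  qed
  then show ?R using f(1) by (simp add: rel_preserving_def)
next
  assume ?R
  then have f: "f \<in> X \<rightarrow>\<^sub>E X"
    and pres: "\<And>x y. x \<in> X \<Longrightarrow> y \<in> X \<Longrightarrow> (x, y) \<in> block_rel I B \<Longrightarrow> (f x, f y) \<in> block_rel I B"
    unfolding rel_preserving_def by auto
  have "\<exists>j\<in>I. f ` B i \<subseteq> B j" if i: "i \<in> I" for i
  proof -
    have sub: "B i \<subseteq> X" using P i by (auto simp: indexed_partition_def)
    obtain x where x: "x \<in> B i" using P i by (auto simp: indexed_partition_def)
    have E: "(f x, f y) \<in> block_rel I B" if "y \<in> B i" for y
      using pres[of x y] x that i sub by (auto simp: block_rel_def)
    obtain j where j: "j \<in> I" "f x \<in> B j"
      using E[OF x] by (auto simp: block_rel_def)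
    have "f y \<in> B j" if "y \<in> B i" for y
      using E[OF that] j indexed_partition_unique[OF P] by (auto simp: block_rel_def)
    then show ?thesis using j by blast
  qed
  then show ?L
    using f by (simp add: transf_partition_def full_transf_def)
qed

lemma mult_transf_partition:
  "u \<otimes>\<^bsub>transf_partition X I B\<^esub> v = compose X v u"
  by (simp add: transf_partition_def full_transf_def)

text \<open>A class that meets \<open>Y\<close> is collapsed, outside \<open>Y\<close>, to the image of one chosen point of \<open>Y\<close> in
  that class; a class that misses \<open>Y\<close> is left fixed.\<close>

lemma rel_preserving_extend:
  assumes E: "equiv X E" and Y: "Y \<subseteq> X" and \<phi>: "rel_preserving E Y X \<phi>"
  shows "\<exists>v. rel_preserving E X X v \<and> (\<forall>y\<in>Y. v y = \<phi> y)"
proof -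
  have \<phi>X: "\<phi> y \<in> X" if "y \<in> Y" for y
    using \<phi> that by (auto simp: rel_preserving_def)
  have \<phi>E: "(\<phi> x, \<phi> y) \<in> E" if "x \<in> Y" "y \<in> Y" "(x, y) \<in> E" for x y
    using \<phi> that by (auto simp: rel_preserving_def)
  have sym: "(y, x) \<in> E" if "(x, y) \<in> E" for x y
    using E that by (meson equiv_def symD)
  have trans: "(x, z) \<in> E" if "(x, y) \<in> E" "(y, z) \<in> E" for x y z
    using E that by (meson equiv_def transD)
  have refl: "(x, x) \<in> E" if "x \<in> X" for x
    using E that by (meson equiv_def refl_onD)
  \<comment> \<open>\<open>r\<close> retracts the classes that meet \<open>Y\<close> into \<open>Y\<close>; it fixes \<open>Y\<close>, so that \<open>v\<close> agrees there with \<open>\<phi>\<close>.\<close>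
  define r where "r x = (if x \<in> Y then x else SOME y. y \<in> Y \<and> (x, y) \<in> E)" for x
  have r: "r x \<in> Y \<and> (x, r x) \<in> E" if "y \<in> Y" "(x, y) \<in> E" for x y
  proof (cases "x \<in> Y")
    case True
    then show ?thesis using refl Y by (auto simp: r_def)
  next
    case False
    then show ?thesis
      using someI[of "\<lambda>z. z \<in> Y \<and> (x, z) \<in> E" y] that by (simp add: r_def)
  qed
  define v where "v = (\<lambda>x\<in>X. if \<exists>y\<in>Y. (x, y) \<in> E then \<phi> (r x) else x)"
  have "v \<in> X \<rightarrow>\<^sub>E X"
    using r \<phi>X by (auto simp: v_def)
  moreover have "(v x, v y) \<in> E" if xy: "x \<in> X" "y \<in> X" "(x, y) \<in> E" for x y
  proof (cases "\<exists>z\<in>Y. (x, z) \<in> E")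
    case True
    then obtain z where z: "z \<in> Y" "(x, z) \<in> E" by blast
    have yz: "(y, z) \<in> E" using trans sym xy(3) z(2) by blast
    have "(r x, r y) \<in> E"
      using r[OF z] r[OF z(1) yz] xy(3) trans sym by blast
    then have "(\<phi> (r x), \<phi> (r y)) \<in> E"
      using \<phi>E r[OF z] r[OF z(1) yz] by blast
    then show ?thesis using xy z yz by (auto simp: v_def)
  next
    case False
    then have "\<not> (\<exists>z\<in>Y. (y, z) \<in> E)" using trans xy(3) by blast
    then show ?thesis using xy False by (simp add: v_def)
  qed
  moreover have "v y = \<phi> y" if "y \<in> Y" for y
    using that Y refl by (auto simp: v_def r_def)
  ultimately show ?thesis unfolding rel_preserving_def by blast
qed

lemma mem_principal_ideal_iff:
  assumes P: "indexed_partition X I B"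
    and f: "f \<in> carrier (transf_partition X I B)"
    and g: "g \<in> carrier (transf_partition X I B)"
  shows "f \<in> carrier (transf_partition X I B) <#>\<^bsub>transf_partition X I B\<^esub> {g}
             <#>\<^bsub>transf_partition X I B\<^esub> carrier (transf_partition X I B) \<longleftrightarrow>
    (\<exists>\<phi>. rel_preserving (block_rel I B) (g ` X) X \<phi> \<and>
         (\<forall>i\<in>I. \<exists>j\<in>I. f ` B i \<subseteq> \<phi> ` (g ` B j)))"
    (is "?L \<longleftrightarrow> ?R")
proof -
  let ?S = "transf_partition X I B" and ?E = "block_rel I B"
  have sub: "B i \<subseteq> X" if "i \<in> I" for i
    using P that by (auto simp: indexed_partition_def)
  have fX: "f \<in> X \<rightarrow>\<^sub>E X" and gX: "g \<in> X \<rightarrow>\<^sub>E X"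
    using f g by (simp_all add: transf_partition_def full_transf_def)
  then have gY: "g ` X \<subseteq> X" by auto
  show ?thesis
  proof
    assume ?L
    then obtain u v where u: "u \<in> carrier ?S" and v: "v \<in> carrier ?S"
      and eq: "f = compose X v (compose X g u)"
      unfolding mem_principal_ideal mult_transf_partition by blast
    have uX: "u \<in> X \<rightarrow> X" using u by (auto simp: transf_partition_def full_transf_def)
    have vE: "rel_preserving ?E X X v"
      using v carrier_transf_partition_iff[OF P] by blast
    define \<phi> where "\<phi> = restrict v (g ` X)"
    have "rel_preserving ?E (g ` X) X \<phi>"
      using vE gY unfolding rel_preserving_def \<phi>_def by (auto simp: PiE_def Pi_def subset_iff)
    moreover have "\<exists>j\<in>I. f ` B i \<subseteq> \<phi> ` (g ` B j)" if i: "i \<in> I" for i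
    proof -
      obtain j where j: "j \<in> I" "u ` B i \<subseteq> B j"
        using u i by (auto simp: transf_partition_def full_transf_def)
      have "f x \<in> \<phi> ` (g ` B j)" if x: "x \<in> B i" for x
      proof -
        have "x \<in> X" using x sub[OF i] by blast
        then have "f x = \<phi> (g (u x))"
          using uX by (auto simp: eq \<phi>_def compose_def)
        then show ?thesis using j x by blast
      qed
      then show ?thesis using j(1) by blast
    qed
    ultimately show ?R by blast
  next
    assume ?R
    then obtain \<phi> where \<phi>: "rel_preserving ?E (g ` X) X \<phi>"
      and cover: "\<forall>i\<in>I. \<exists>j\<in>I. f ` B i \<subseteq> \<phi> ` (g ` B j)" by blast
    obtain v where v: "rel_preserving ?E X X v" and v\<phi>: "\<And>y. y \<in> g ` X \<Longrightarrow> v y = \<phi> y"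
      using rel_preserving_extend[OF equiv_block_rel[OF P] gY \<phi>] by blast
    \<comment> \<open>The target block \<open>J i\<close> is fixed before the preimages are, so that all of \<open>B i\<close> lands in it.\<close>
    obtain J where J: "\<And>i. i \<in> I \<Longrightarrow> J i \<in> I \<and> f ` B i \<subseteq> \<phi> ` (g ` B (J i))"
      using cover by metis
    have "\<exists>y. \<forall>i\<in>I. x \<in> B i \<longrightarrow> y \<in> B (J i) \<and> f x = \<phi> (g y)" if x: "x \<in> X" for x
    proof -
      obtain i where i: "i \<in> I" "x \<in> B i" using P x unfolding indexed_partition_def by blast
      then obtain y where "y \<in> B (J i)" "f x = \<phi> (g y)" using J[OF i(1)] by blast
      then show ?thesis using i indexed_partition_unique[OF P] by metis
    qed
    then obtain w where w: "\<And>x i. x \<in> X \<Longrightarrow> i \<in> I \<Longrightarrow> x \<in> B i \<Longrightarrow> w x \<in> B (J i) \<and> f x = \<phi> (g (w x))"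
      by metis
    have wX: "w x \<in> X \<and> f x = \<phi> (g (w x))" if x: "x \<in> X" for x
    proof -
      obtain i where i: "i \<in> I" "x \<in> B i" using P x unfolding indexed_partition_def by blast
      then show ?thesis using w[OF x i] J[OF i(1)] sub by blast
    qed
    have "restrict w X ` B i \<subseteq> B (J i)" if "i \<in> I" for i
      using w that sub[OF that] by auto
    then have "restrict w X \<in> carrier ?S"
      using wX J by (simp add: transf_partition_def full_transf_def) blast
    moreover have "v \<in> carrier ?S"
      using v carrier_transf_partition_iff[OF P] by blast
    moreover have "f = compose X v (compose X g (restrict w X))"
    proof (rule extensionalityI[of _ X])
      show "f \<in> extensional X" using fX by (simp add: PiE_def)
    next
      fix x assume "x \<in> X"
      then show "f x = compose X v (compose X g (restrict w X)) x"
        using wX[of x] v\<phi>[of "g (w x)"] by (simp add: compose_def)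
    qed simp
    ultimately show ?L
      unfolding mem_principal_ideal mult_transf_partition by blast
  qed
qed

theorem proposition5p13:
  fixes X :: "'a set" and I :: "'i set" and B :: "'i \<Rightarrow> 'a set" and f g :: "'a \<Rightarrow> 'a"
  assumes "X \<noteq> {}"
    and "indexed_partition X I B"
    and "f \<in> carrier (transf_partition X I B)"
    and "g \<in> carrier (transf_partition X I B)"
  shows "(f, g) \<in> Green_J (transf_partition X I B) \<longleftrightarrow>
    (\<exists>\<phi> \<psi>. rel_preserving (block_rel I B) (g ` X) X \<phi> \<and>
           rel_preserving (block_rel I B) (f ` X) X \<psi> \<and>
           (\<forall>i\<in>I. \<exists>j\<in>I. \<exists>k\<in>I. f ` B i \<subseteq> \<phi> ` (g ` B j) \<and> g ` B i \<subseteq> \<psi> ` (f ` B k)))"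
proof -
  have split: "(\<forall>i\<in>I. \<exists>j\<in>I. \<exists>k\<in>I. P i j \<and> Q i k) \<longleftrightarrow>
      (\<forall>i\<in>I. \<exists>j\<in>I. P i j) \<and> (\<forall>i\<in>I. \<exists>k\<in>I. Q i k)" for P Q :: "'i \<Rightarrow> 'i \<Rightarrow> bool"
    by blast
  show ?thesis
    unfolding monoid.Green_J_iff[OF monoid_transf_partition[OF assms(2)] assms(3,4)]
      mem_principal_ideal_iff[OF assms(2-4)] mem_principal_ideal_iff[OF assms(2,4,3)] split
    by iprover
qed

end
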